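(* Let $(G,\cdot,\circ)$ be a skew left brace such that the group $(G,\cdot)$ is complete. Then there exists a Rota--Baxter operator $B$ on $(G,\cdot)$ such that $(G,\cdot,\circ)=(G,\cdot,\circ_B)$, i.e. $x\circ y=xB(x)yB(x)^{-1}$ for all $x,y\in G$.
   Context: A skew left brace is a set $A$ with two binary operations $\cdot$ and $\circ$ such that $(A,\cdot)$ and $(A,\circ)$ are groups and $a\circ(b\cdot c)=(a\circ b)\cdot a^{-1}\cdot(a\circ c)$ for all $a,b,c\in A$, where $a^{-1}$ is the inverse of $a$ in $(A,\cdot)$. A Rota--Baxter operator (of weight 1) on a group $G$ is a map $B\colon G\to G$ such that $B(g)B(h)=B(gB(g)hB(g)^{-1})$ for all $g,h\in G$. For such $B$, $x\circ_B y = xB(x)yB(x)^{-1}$. A group is called complete if its center is trivial and its group of outer automorphisms is trivial. *)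

theory Defs
  imports "HOL-Algebra.Elementary_Groups" "HOL-Algebra.Bij"
begin

section \<open>Complete groups\<close>

definition center :: "('a, 'b) monoid_scheme \<Rightarrow> 'a set"
  where "center G = {z \<in> carrier G. \<forall>g \<in> carrier G. z \<otimes>\<^bsub>G\<^esub> g = g \<otimes>\<^bsub>G\<^esub> z}"

text \<open>Restricted to the carrier because \<^const>\<open>AutoGroup\<close> consists of extensional functions.\<close>

definition conjugation :: "('a, 'b) monoid_scheme \<Rightarrow> 'a \<Rightarrow> 'a \<Rightarrow> 'a"
  where "conjugation G g = (\<lambda>x \<in> carrier G. g \<otimes>\<^bsub>G\<^esub> x \<otimes>\<^bsub>G\<^esub> inv\<^bsub>G\<^esub> g)"

definition inner_automorphisms :: "('a, 'b) monoid_scheme \<Rightarrow> ('a \<Rightarrow> 'a) set"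
  where "inner_automorphisms G = conjugation G ` carrier G"

definition OuterAutoGroup :: "('a, 'b) monoid_scheme \<Rightarrow> ('a \<Rightarrow> 'a) set monoid"
  where "OuterAutoGroup G = AutoGroup G Mod inner_automorphisms G"

locale complete_group = group +
  assumes center_trivial: "center G = {\<one>}"
    and outer_trivial: "trivial_group (OuterAutoGroup G)"

context group
begin

lemma conjugation_closed: "\<lbrakk>g \<in> carrier G; x \<in> carrier G\<rbrakk> \<Longrightarrow> conjugation G g x \<in> carrier G"
  by (simp add: conjugation_def)

lemma compose_conjugation:
  assumes "g \<in> carrier G" "h \<in> carrier G"
  shows "compose (carrier G) (conjugation G g) (conjugation G h) = conjugation G (g \<otimes> h)"
  using assms by (auto simp: compose_def conjugation_def inv_mult_group m_assoc)

lemma conjugation_one: "conjugation G \<one> = (\<lambda>x \<in> carrier G. x)"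
  by (auto simp: conjugation_def)

lemma conjugation_auto:
  assumes g: "g \<in> carrier G"
  shows "conjugation G g \<in> auto G"
proof -
  have inverse: "conjugation G a (conjugation G b x) = x"
    if "a \<in> carrier G" "b \<in> carrier G" "a \<otimes> b = \<one>" "x \<in> carrier G" for a b x
    using that compose_conjugation[of a b] conjugation_one
    by (metis compose_eq restrict_apply)
  have "bij_betw (conjugation G g) (carrier G) (carrier G)"
    by (rule bij_betw_byWitness[where f' = "conjugation G (inv g)"])
       (use g in \<open>auto simp: inverse conjugation_closed\<close>)
  moreover have "conjugation G g (x \<otimes> y) = conjugation G g x \<otimes> conjugation G g y"
    if "x \<in> carrier G" "y \<in> carrier G" for x y
    using that g by (simp add: conjugation_def m_assoc inv_solve_left)
  ultimately show ?thesis
    using g by (auto simp: auto_def Bij_def hom_def conjugation_closed conjugation_def)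
qed

lemma mult_AutoGroup:
  "\<lbrakk>f \<in> auto G; h \<in> auto G\<rbrakk> \<Longrightarrow> f \<otimes>\<^bsub>AutoGroup G\<^esub> h = compose (carrier G) f h"
  by (simp add: AutoGroup_def BijGroup_def auto_def)

lemma carrier_AutoGroup: "carrier (AutoGroup G) = auto G"
  by (simp add: AutoGroup_def)

lemma one_AutoGroup: "\<one>\<^bsub>AutoGroup G\<^esub> = conjugation G \<one>"
  by (simp add: AutoGroup_def BijGroup_def conjugation_one)

lemma conjugation_hom: "conjugation G \<in> hom G (AutoGroup G)"
  by (simp add: hom_def carrier_AutoGroup conjugation_auto mult_AutoGroup compose_conjugation Pi_I)

lemma conjugate_conjugation:
  assumes f: "f \<in> auto G" and g: "g \<in> carrier G"
  shows "f \<otimes>\<^bsub>AutoGroup G\<^esub> conjugation G g = conjugation G (f g) \<otimes>\<^bsub>AutoGroup G\<^esub> f"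
proof -
  interpret f: group_hom G G f
    using f by unfold_locales (simp add: auto_def)
  have "compose (carrier G) f (conjugation G g) = compose (carrier G) (conjugation G (f g)) f"
    using g by (auto simp: compose_def conjugation_def)
  then show ?thesis
    using f g by (simp add: mult_AutoGroup conjugation_auto)
qed

lemma inner_automorphisms_normal: "inner_automorphisms G \<lhd> AutoGroup G"
proof -
  interpret A: group "AutoGroup G" by (rule AutoGroup)
  interpret c: group_hom G "AutoGroup G" "conjugation G"
    by unfold_locales (rule conjugation_hom)
  have "f \<otimes>\<^bsub>AutoGroup G\<^esub> h \<otimes>\<^bsub>AutoGroup G\<^esub> inv\<^bsub>AutoGroup G\<^esub> f \<in> inner_automorphisms G"
    if f: "f \<in> carrier (AutoGroup G)" and h: "h \<in> inner_automorphisms G" for f h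
  proof -
    obtain g where g: "g \<in> carrier G" "h = conjugation G g"
      using h by (auto simp: inner_automorphisms_def)
    have fg: "f g \<in> carrier G"
      using f g by (auto simp: carrier_AutoGroup auto_def hom_def)
    have "f \<otimes>\<^bsub>AutoGroup G\<^esub> h \<otimes>\<^bsub>AutoGroup G\<^esub> inv\<^bsub>AutoGroup G\<^esub> f = conjugation G (f g)"
      using f g fg conjugate_conjugation[of f g]
      by (simp add: A.m_assoc conjugation_auto carrier_AutoGroup[symmetric])
    then show ?thesis
      using fg by (simp add: inner_automorphisms_def)
  qed
  then show ?thesis
    unfolding A.normal_inv_iff
    using c.img_is_subgroup by (simp add: inner_automorphisms_def)
qed

lemma group_OuterAutoGroup: "group (OuterAutoGroup G)"
  unfolding OuterAutoGroup_def by (rule normal.factorgroup_is_group[OF inner_automorphisms_normal])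

end

section \<open>Skew left braces and Rota--Baxter operators\<close>

text \<open>The two group structures of a skew left brace are two records with the same carrier:
  \<open>G\<close> for the multiplicative operation and \<open>C\<close> for the circle operation.\<close>

locale skew_left_brace = mult: group G + circ: group C
  for G :: "('a, 'b) monoid_scheme" (structure)
    and C :: "('a, 'c) monoid_scheme" +
  assumes same_carrier: "carrier C = carrier G"
    and brace_identity: "\<lbrakk>a \<in> carrier G; b \<in> carrier G; c \<in> carrier G\<rbrakk> \<Longrightarrow>
      a \<otimes>\<^bsub>C\<^esub> (b \<otimes> c) = (a \<otimes>\<^bsub>C\<^esub> b) \<otimes> inv a \<otimes> (a \<otimes>\<^bsub>C\<^esub> c)"

definition rota_baxter_operator :: "('a, 'b) monoid_scheme \<Rightarrow> ('a \<Rightarrow> 'a) \<Rightarrow> bool"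
  where "rota_baxter_operator G B \<longleftrightarrow>
    B \<in> carrier G \<rightarrow> carrier G \<and>
    (\<forall>g \<in> carrier G. \<forall>h \<in> carrier G.
      B g \<otimes>\<^bsub>G\<^esub> B h = B (g \<otimes>\<^bsub>G\<^esub> B g \<otimes>\<^bsub>G\<^esub> h \<otimes>\<^bsub>G\<^esub> inv\<^bsub>G\<^esub> (B g)))"

definition rota_baxter_circ :: "('a, 'b) monoid_scheme \<Rightarrow> ('a \<Rightarrow> 'a) \<Rightarrow> 'a \<Rightarrow> 'a \<Rightarrow> 'a"
  where "rota_baxter_circ G B x y = x \<otimes>\<^bsub>G\<^esub> B x \<otimes>\<^bsub>G\<^esub> y \<otimes>\<^bsub>G\<^esub> inv\<^bsub>G\<^esub> (B x)"

end

theory Submission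
  imports Defs
begin

text \<open>
  Write \<open>\<cdot>\<close> and \<open>\<circ>\<close> for the two operations of a skew left brace and put
  \<open>\<lambda>\<^sub>a b = a\<^sup>-\<^sup>1 \<cdot> (a \<circ> b)\<close>, so that \<open>a \<circ> b = a \<cdot> \<lambda>\<^sub>a b\<close>. The brace identity says exactly that
  each \<open>\<lambda>\<^sub>a\<close> is an endomorphism of the multiplicative group; it is bijective because left
  translations of both groups are, and \<open>\<lambda>\<^sub>a \<lambda>\<^sub>b = \<lambda>\<^bsub>a \<circ> b\<^esub>\<close> by associativity of \<open>\<circ>\<close>. So \<open>\<lambda>\<close> is an
  action of the circle group by automorphisms of the multiplicative group \<open>G\<close>.

  For complete \<open>G\<close> the map \<open>conjugation G\<close> is an isomorphism from \<open>G\<close> to its automorphism group: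
  it is onto because there are no outer automorphisms, and one-to-one because its kernel is the
  center. Hence there is a unique \<open>B a\<close> with \<open>\<lambda>\<^sub>a = conjugation G (B a)\<close>, and \<open>B\<close> inherits
  from \<open>\<lambda>\<close> the property of being a homomorphism from the circle group to \<open>G\<close>. Since
  \<open>a \<circ> b = a \<cdot> \<lambda>\<^sub>a b = a \<cdot> B a \<cdot> b \<cdot> (B a)\<^sup>-\<^sup>1\<close>, the equation \<open>B (a \<circ> b) = B a \<cdot> B b\<close> is the
  Rota--Baxter identity.
\<close>

lemma (in group) auto_inner_if_outer_trivial:
  assumes "trivial_group (OuterAutoGroup G)"
  shows "auto G \<subseteq> inner_automorphisms G"
proof
  fix f assume f: "f \<in> auto G"
  interpret A: group "AutoGroup G" by (rule AutoGroup)
  interpret N: normal "inner_automorphisms G" "AutoGroup G"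
    by (rule inner_automorphisms_normal)
  have f': "f \<in> carrier (AutoGroup G)"
    using f by (simp add: carrier_AutoGroup)
  have "inner_automorphisms G #>\<^bsub>AutoGroup G\<^esub> f \<in> carrier (OuterAutoGroup G)"
    using f' by (auto simp: OuterAutoGroup_def FactGroup_def RCOSETS_def)
  then have "inner_automorphisms G #>\<^bsub>AutoGroup G\<^esub> f = inner_automorphisms G"
    using assms by (simp add: trivial_group_def OuterAutoGroup_def FactGroup_def)
  then show "f \<in> inner_automorphisms G"
    using A.rcos_self[OF f' N.subgroup_axioms] by simp
qed

text \<open>If \<open>g\<close> and \<open>h\<close> induce the same inner automorphism, then \<open>h\<^sup>-\<^sup>1 g\<close> is central.\<close>
lemma (in group) conjugation_inj_if_center_trivial:
  assumes "center G = {\<one>}"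
  shows "inj_on (conjugation G) (carrier G)"
proof (rule inj_onI)
  fix g h assume g: "g \<in> carrier G" and h: "h \<in> carrier G"
    and eq: "conjugation G g = conjugation G h"
  have "inv h \<otimes> g \<otimes> x = x \<otimes> (inv h \<otimes> g)" if x: "x \<in> carrier G" for x
  proof -
    have "g \<otimes> x \<otimes> inv g = h \<otimes> x \<otimes> inv h"
      using fun_cong[OF eq, of x] x by (simp add: conjugation_def)
    then have "inv h \<otimes> (g \<otimes> x \<otimes> inv g) \<otimes> g = inv h \<otimes> (h \<otimes> x \<otimes> inv h) \<otimes> g"
      by simp
    moreover have "inv h \<otimes> (g \<otimes> x \<otimes> inv g) \<otimes> g = inv h \<otimes> g \<otimes> x"
      using g h x by (simp add: m_assoc)
    moreover have "inv h \<otimes> (h \<otimes> x \<otimes> inv h) \<otimes> g = x \<otimes> (inv h \<otimes> g)"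
      using g h x by (simp add: m_assoc inv_solve_left')
    ultimately show ?thesis by simp
  qed
  then have "inv h \<otimes> g \<in> center G"
    using g h by (simp add: center_def)
  then have "inv h \<otimes> g = \<one>"
    using assms by simp
  then show "g = h"
    using g h by (metis inv_closed inv_equality inv_inv)
qed

context skew_left_brace
begin

text \<open>Restricted to the carrier so that its values are elements of \<^const>\<open>AutoGroup\<close>.\<close>
definition lambda_map :: "'a \<Rightarrow> 'a \<Rightarrow> 'a"
  where "lambda_map a = (\<lambda>b \<in> carrier G. inv a \<otimes> (a \<otimes>\<^bsub>C\<^esub> b))"

lemma circ_closed:
  "\<lbrakk>a \<in> carrier G; b \<in> carrier G\<rbrakk> \<Longrightarrow> a \<otimes>\<^bsub>C\<^esub> b \<in> carrier G"
  using circ.m_closed by (simp add: same_carrier)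

lemma lambda_map_closed:
  "\<lbrakk>a \<in> carrier G; b \<in> carrier G\<rbrakk> \<Longrightarrow> lambda_map a b \<in> carrier G"
  by (simp add: lambda_map_def circ_closed)

lemma circ_eq_mult_lambda_map:
  assumes "a \<in> carrier G" "b \<in> carrier G"
  shows "a \<otimes>\<^bsub>C\<^esub> b = a \<otimes> lambda_map a b"
  using assms by (simp add: lambda_map_def circ_closed mult.m_assoc[symmetric])

lemma lambda_map_mult:
  assumes "a \<in> carrier G" "b \<in> carrier G" "c \<in> carrier G"
  shows "lambda_map a (b \<otimes> c) = lambda_map a b \<otimes> lambda_map a c"
  using assms by (simp add: lambda_map_def brace_identity circ_closed mult.m_assoc)

text \<open>The equation \<open>\<lambda>\<^sub>a b = y\<close> says \<open>a \<circ> b = a \<cdot> y\<close>, whose unique solution in the circle group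
  is the inverse used below.\<close>
lemma lambda_map_auto:
  assumes a: "a \<in> carrier G"
  shows "lambda_map a \<in> auto G"
proof -
  have inv_a: "inv\<^bsub>C\<^esub> a \<in> carrier G"
    using a circ.inv_closed by (simp add: same_carrier)
  have cancel: "inv\<^bsub>C\<^esub> a \<otimes>\<^bsub>C\<^esub> (a \<otimes>\<^bsub>C\<^esub> b) = b" "a \<otimes>\<^bsub>C\<^esub> (inv\<^bsub>C\<^esub> a \<otimes>\<^bsub>C\<^esub> b) = b"
    if "b \<in> carrier G" for b
    using a inv_a that circ.m_assoc[symmetric] circ.l_inv circ.r_inv circ.l_one
    by (simp_all add: same_carrier)
  have "bij_betw (lambda_map a) (carrier G) (carrier G)"
  proof (rule bij_betw_byWitness[where f' = "\<lambda>y. inv\<^bsub>C\<^esub> a \<otimes>\<^bsub>C\<^esub> (a \<otimes> y)"])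
    show "\<forall>b\<in>carrier G. inv\<^bsub>C\<^esub> a \<otimes>\<^bsub>C\<^esub> (a \<otimes> lambda_map a b) = b"
      using a by (simp add: circ_eq_mult_lambda_map[symmetric] cancel)
    show "\<forall>y\<in>carrier G. lambda_map a (inv\<^bsub>C\<^esub> a \<otimes>\<^bsub>C\<^esub> (a \<otimes> y)) = y"
      using a inv_a by (simp add: lambda_map_def circ_closed cancel mult.m_assoc[symmetric])
  qed (use a inv_a in \<open>auto simp: lambda_map_closed circ_closed\<close>)
  moreover have "lambda_map a \<in> extensional (carrier G)"
    by (simp add: lambda_map_def)
  ultimately show ?thesis
    using a by (simp add: auto_def Bij_def hom_def lambda_map_closed lambda_map_mult)
qed

lemma lambda_map_circ:
  assumes a: "a \<in> carrier G" and b: "b \<in> carrier G"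
  shows "lambda_map (a \<otimes>\<^bsub>C\<^esub> b) = compose (carrier G) (lambda_map a) (lambda_map b)"
proof
  fix c
  show "lambda_map (a \<otimes>\<^bsub>C\<^esub> b) c = compose (carrier G) (lambda_map a) (lambda_map b) c"
  proof (cases "c \<in> carrier G")
    case c: True
    \<comment> \<open>Both sides agree after left multiplication by \<open>a \<circ> b = a \<cdot> \<lambda>\<^sub>a b\<close>.\<close>
    have "(a \<otimes>\<^bsub>C\<^esub> b) \<otimes> lambda_map (a \<otimes>\<^bsub>C\<^esub> b) c = a \<otimes>\<^bsub>C\<^esub> (b \<otimes>\<^bsub>C\<^esub> c)"
      using a b c circ.m_assoc
      by (simp add: circ_eq_mult_lambda_map[symmetric] circ_closed same_carrier)
    also have "\<dots> = a \<otimes> lambda_map a (b \<otimes> lambda_map b c)"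
      using a b c by (metis circ_eq_mult_lambda_map circ_closed)
    also have "\<dots> = (a \<otimes>\<^bsub>C\<^esub> b) \<otimes> lambda_map a (lambda_map b c)"
      using a b c
      by (simp add: lambda_map_mult lambda_map_closed circ_eq_mult_lambda_map mult.m_assoc)
    finally show ?thesis
      using a b c by (simp add: compose_eq circ_closed lambda_map_closed)
  next
    case False
    then show ?thesis by (simp add: lambda_map_def compose_def)
  qed
qed

text \<open>That conjugation reaches every \<open>\<lambda>\<^sub>a\<close> provides \<open>B\<close>; that it is injective makes \<open>B\<close> a
  homomorphism from the circle group, which is the Rota--Baxter identity.\<close>
lemma rota_baxter_if_lambda_map_inner:
  assumes inner: "\<And>a. a \<in> carrier G \<Longrightarrow> lambda_map a \<in> inner_automorphisms G"
    and inj: "inj_on (conjugation G) (carrier G)"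
  shows "\<exists>B. rota_baxter_operator G B \<and>
    (\<forall>x \<in> carrier G. \<forall>y \<in> carrier G. x \<otimes>\<^bsub>C\<^esub> y = rota_baxter_circ G B x y)"
proof -
  have "\<forall>a\<in>carrier G. \<exists>g\<in>carrier G. lambda_map a = conjugation G g"
    using inner unfolding inner_automorphisms_def by blast
  then obtain B where B: "\<And>a. a \<in> carrier G \<Longrightarrow> B a \<in> carrier G"
    and lambda_B: "\<And>a. a \<in> carrier G \<Longrightarrow> lambda_map a = conjugation G (B a)"
    by metis
  have circ_B: "x \<otimes>\<^bsub>C\<^esub> y = x \<otimes> B x \<otimes> y \<otimes> inv (B x)"
    if "x \<in> carrier G" "y \<in> carrier G" for x y
    using that B by (simp add: circ_eq_mult_lambda_map lambda_B conjugation_def mult.m_assoc)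
  have "B x \<otimes> B y = B (x \<otimes>\<^bsub>C\<^esub> y)" if x: "x \<in> carrier G" and y: "y \<in> carrier G" for x y
  proof -
    have "conjugation G (B x \<otimes> B y) = compose (carrier G) (lambda_map x) (lambda_map y)"
      using x y B by (simp add: lambda_B mult.compose_conjugation)
    also have "\<dots> = conjugation G (B (x \<otimes>\<^bsub>C\<^esub> y))"
      using lambda_map_circ[OF x y] lambda_B[OF circ_closed[OF x y]] by simp
    finally show ?thesis
      using inj_onD[OF inj] x y B by (simp add: circ_closed)
  qed
  then have "rota_baxter_operator G B"
    using B circ_B by (simp add: rota_baxter_operator_def)
  then show ?thesis
    using circ_B by (auto simp: rota_baxter_circ_def)
qed

end

theorem proposition3p12:
  fixes G :: "('a, 'b) monoid_scheme" and C :: "('a, 'c) monoid_scheme"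
  assumes "skew_left_brace G C"
    and "complete_group G"
  shows "\<exists>B. rota_baxter_operator G B \<and>
    (\<forall>x \<in> carrier G. \<forall>y \<in> carrier G. x \<otimes>\<^bsub>C\<^esub> y = rota_baxter_circ G B x y)"
proof -
  interpret skew_left_brace G C by fact
  interpret complete_group G by fact
  show ?thesis
    using rota_baxter_if_lambda_map_inner lambda_map_auto
      mult.auto_inner_if_outer_trivial[OF outer_trivial]
      mult.conjugation_inj_if_center_trivial[OF center_trivial]
    by blast
qed

end
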